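(* Let $\boldsymbol{u}$ be a (bi-directional) fixed point of a primitive substitution $\varphi$ over an alphabet $\mathcal{A}$. If there exists a non-trivial geometric representation of $\boldsymbol{u}$ which is bounded distance equivalent to a lattice, then at least one eigenvalue of the incidence matrix $M_\varphi$ has modulus less than or equal to $1$.
   Context: Alphabet $\mathcal{A}=\{1,\dots,d\}$. The incidence matrix $M_\varphi$ has entries $(M_\varphi)_{ba}=|\varphi(a)|_b$, the number of occurrences of $b$ in $\varphi(a)$. For a bi-directional infinite word $\boldsymbol{u}=\cdots u_{-1}|u_0u_1\cdots$, $\vec{P}_n(\boldsymbol{u})$ denotes the Parikh vector $(|w|_1,\dots,|w|_d)^{\mathrm T}$ of $w=u_0\cdots u_{n-1}$ if $n\ge0$, and minus the Parikh vector of $u_n\cdots u_{-1}$ if $n<0$. Given positive lengths $\ell_1,\dots,\ell_d$, the geometric representation of $\boldsymbol{u}$ is $\{x_n:n\in\mathbb{Z}\}$ with $x_n=(\ell_1,\dots,\ell_d)\vec{P}_n(\boldsymbol{u})$; it is non-trivial if at least two lengths differ. A set $\Lambda\subset\mathbb{R}$ is bounded distance equivalent to a lattice $\eta\mathbb{Z}$ if there is a bijection $g:\Lambda\to\eta\mathbb{Z}$ and a constant $C$ with $|x-g(x)|<C$ for all $x\in\Lambda$. *)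

theory Defs
  imports Complex_Main "Jordan_Normal_Form.Char_Poly"
begin

text \<open>
  The alphabet is \<open>{1..d}\<close>. Vectors and matrices are those of Jordan_Normal_Form, whose indices
  start at \<open>0\<close>; thus the index \<open>i < d\<close> belongs to the letter \<open>Suc i\<close>.
\<close>

definition morph :: "(nat \<Rightarrow> nat list) \<Rightarrow> nat list \<Rightarrow> nat list" where
  "morph \<phi> w = concat (map \<phi> w)"

definition substitution :: "nat \<Rightarrow> (nat \<Rightarrow> nat list) \<Rightarrow> bool" where
  "substitution d \<phi> \<longleftrightarrow> (\<forall>a\<in>{1..d}. \<phi> a \<noteq> [] \<and> set (\<phi> a) \<subseteq> {1..d})"

definition primitive_substitution :: "nat \<Rightarrow> (nat \<Rightarrow> nat list) \<Rightarrow> bool" where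
  "primitive_substitution d \<phi> \<longleftrightarrow>
     substitution d \<phi> \<and>
     (\<exists>k\<ge>1. \<forall>a\<in>{1..d}. \<forall>b\<in>{1..d}. b \<in> set ((morph \<phi> ^^ k) [a]))"

definition incidence_matrix :: "nat \<Rightarrow> (nat \<Rightarrow> nat list) \<Rightarrow> complex mat" where
  "incidence_matrix d \<phi> = mat d d (\<lambda>(b, a). of_nat (count_list (\<phi> (Suc a)) (Suc b)))"

text \<open>
  The image \<open>\<cdots>\<phi>(u\<^bsub>-2\<^esub>)\<phi>(u\<^bsub>-1\<^esub>)|\<phi>(u\<^sub>0)\<phi>(u\<^sub>1)\<cdots>\<close> of a bi-directional word. As \<open>\<phi>\<close> is
  non-erasing, the letter at position \<open>n \<ge> 0\<close> can be read off from \<open>\<phi>(u\<^sub>0\<cdots>u\<^sub>n)\<close>, which has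
  length at least \<open>n + 1\<close>; for \<open>n < 0\<close> it is the \<open>(-n)\<close>-th letter from the right of
  \<open>\<phi>(u\<^sub>n\<cdots>u\<^bsub>-1\<^esub>)\<close>, which has length at least \<open>-n\<close>.
\<close>

definition morph_biinf :: "(nat \<Rightarrow> nat list) \<Rightarrow> (int \<Rightarrow> nat) \<Rightarrow> int \<Rightarrow> nat" where
  "morph_biinf \<phi> u n =
     (if n \<ge> 0 then morph \<phi> (map u [0..n]) ! nat n
      else rev (morph \<phi> (map u [n..-1])) ! nat (- n - 1))"

definition biinf_word :: "nat \<Rightarrow> (int \<Rightarrow> nat) \<Rightarrow> bool" where
  "biinf_word d u \<longleftrightarrow> range u \<subseteq> {1..d}"

definition parikh :: "nat \<Rightarrow> nat list \<Rightarrow> real vec" where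
  "parikh d w = vec d (\<lambda>i. of_nat (count_list w (Suc i)))"

definition parikh_biinf :: "nat \<Rightarrow> (int \<Rightarrow> nat) \<Rightarrow> int \<Rightarrow> real vec" where
  "parikh_biinf d u n =
     (if n \<ge> 0 then parikh d (map u [0..n - 1]) else - parikh d (map u [n..-1]))"

definition lengths :: "nat \<Rightarrow> real vec \<Rightarrow> bool" where
  "lengths d l \<longleftrightarrow> l \<in> carrier_vec d \<and> (\<forall>i<d. l $ i > 0)"

definition nontrivial_lengths :: "nat \<Rightarrow> real vec \<Rightarrow> bool" where
  "nontrivial_lengths d l \<longleftrightarrow> (\<exists>i<d. \<exists>j<d. l $ i \<noteq> l $ j)"

definition geometric_rep :: "nat \<Rightarrow> real vec \<Rightarrow> (int \<Rightarrow> nat) \<Rightarrow> real set" where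
  "geometric_rep d l u = range (\<lambda>n. l \<bullet> parikh_biinf d u n)"

definition int_lattice :: "real \<Rightarrow> real set" where
  "int_lattice \<eta> = range (\<lambda>k::int. \<eta> * of_int k)"

definition bounded_distance_equiv :: "real set \<Rightarrow> real set \<Rightarrow> bool" where
  "bounded_distance_equiv \<Lambda> \<Lambda>' \<longleftrightarrow>
     (\<exists>g C. bij_betw g \<Lambda> \<Lambda>' \<and> (\<forall>x\<in>\<Lambda>. \<bar>x - g x\<bar> < C))"

end

theory Submission
  imports Defs "Jordan_Normal_Form.Spectral_Radius"
begin

text \<open>
  Counting points of both sets in a long interval shows that bounded distance equivalence to
  \<open>\<eta>\<int>\<close> forces \<open>x\<^sub>n - \<eta> n\<close> to be bounded. In other words, the non-zero weights \<open>f\<^sub>a = \<ell>\<^sub>a - \<eta>\<close>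
  have bounded sums over all prefixes of \<open>u\<^sub>0u\<^sub>1\<cdots>\<close>. As \<open>\<phi>\<close> maps prefixes to prefixes and every
  letter occurs in \<open>u\<^sub>0u\<^sub>1\<cdots>\<close>, the weights of the words \<open>\<phi>\<^sup>k(a)\<close>, which are the entries of the
  row vectors \<open>f M\<^sup>k\<close>, are bounded too. If all eigenvalues of \<open>M\<close> had modulus greater than \<open>1\<close>,
  the powers of \<open>M\<^sup>-\<^sup>1\<close> would decay geometrically and only \<open>f = 0\<close> could have a bounded orbit.
\<close>

section \<open>Bounded orbits of matrices\<close>

lemma smult_mat_mult_vec:
  fixes A :: "'a :: comm_semiring_0 mat"
  assumes "A \<in> carrier_mat m n" and "v \<in> carrier_vec n"
  shows "(c \<cdot>\<^sub>m A) *\<^sub>v v = c \<cdot>\<^sub>v (A *\<^sub>v v)"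
  using assms by (intro eq_vecI) (auto simp: scalar_prod_def sum_distrib_left ac_simps)

lemma zero_smult_vec:
  fixes v :: "'a :: mult_zero vec"
  shows "v \<in> carrier_vec n \<Longrightarrow> 0 \<cdot>\<^sub>v v = 0\<^sub>v n"
  by (intro eq_vecI) auto

text \<open>Applying \<open>A\<close> to \<open>B *\<^sub>v v = \<mu> \<cdot>\<^sub>v v\<close>
  gives \<open>v = \<mu> \<cdot>\<^sub>v (A *\<^sub>v v)\<close>, from which both claims can be read
  off.\<close>

lemma eigenvalue_inverse_mat:
  fixes A B :: "'a :: field mat"
  assumes A: "A \<in> carrier_mat n n" and B: "B \<in> carrier_mat n n"
    and AB: "A * B = 1\<^sub>m n"
    and ev: "eigenvalue B \<mu>"
  shows "\<mu> \<noteq> 0" and "eigenvalue A (inverse \<mu>)"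
proof -
  from ev B obtain v where v: "v \<in> carrier_vec n" "v \<noteq> 0\<^sub>v n" and Bv: "B *\<^sub>v v = \<mu> \<cdot>\<^sub>v v"
    unfolding eigenvalue_def eigenvector_def by auto
  have "v = (A * B) *\<^sub>v v"
    using AB v by simp
  also have "\<dots> = A *\<^sub>v (\<mu> \<cdot>\<^sub>v v)"
    using A B v Bv by simp
  also have "\<dots> = \<mu> \<cdot>\<^sub>v (A *\<^sub>v v)"
    using A v by (simp add: mult_mat_vec)
  finally have veq: "v = \<mu> \<cdot>\<^sub>v (A *\<^sub>v v)" .
  show mu: "\<mu> \<noteq> 0"
  proof
    assume "\<mu> = 0"
    then have "v = 0\<^sub>v n"
      using veq zero_smult_vec[OF mult_mat_vec_carrier[OF A v(1)]] by simp
    with v show False by simp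
  qed
  have "inverse \<mu> \<cdot>\<^sub>v v = A *\<^sub>v v"
    by (subst veq) (simp add: smult_smult_assoc mu)
  then show "eigenvalue A (inverse \<mu>)"
    unfolding eigenvalue_def eigenvector_def using A v by auto
qed

lemma eigenvalue_smult_mat:
  fixes A :: "'a :: field mat"
  assumes A: "A \<in> carrier_mat n n" and c: "c \<noteq> 0" and ev: "eigenvalue (c \<cdot>\<^sub>m A) \<mu>"
  shows "eigenvalue A (\<mu> / c)"
proof -
  from ev A obtain v where v: "v \<in> carrier_vec n" "v \<noteq> 0\<^sub>v n"
    and cAv: "(c \<cdot>\<^sub>m A) *\<^sub>v v = \<mu> \<cdot>\<^sub>v v"
    unfolding eigenvalue_def eigenvector_def by auto
  have "c \<cdot>\<^sub>v (A *\<^sub>v v) = \<mu> \<cdot>\<^sub>v v"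
    using cAv smult_mat_mult_vec[OF A v(1)] by simp
  then have "inverse c \<cdot>\<^sub>v (c \<cdot>\<^sub>v (A *\<^sub>v v)) = inverse c \<cdot>\<^sub>v (\<mu> \<cdot>\<^sub>v v)"
    by simp
  then have "A *\<^sub>v v = (\<mu> / c) \<cdot>\<^sub>v v"
    using c by (simp add: smult_smult_assoc field_simps)
  then show ?thesis
    unfolding eigenvalue_def eigenvector_def using A v by auto
qed

text \<open>Otherwise \<open>A\<close> is invertible and some multiple of its inverse by a factor
  above 1 still has spectral radius below 1. Powers of that multiple are bounded, yet they carry the
  bounded vectors \<open>w k\<close> to ever larger multiples of \<open>w 0\<close>.\<close>

lemma bounded_orbit_eigenvalue:
  fixes A :: "complex mat" and w :: "nat \<Rightarrow> complex vec"
  assumes A: "A \<in> carrier_mat n n"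
    and w: "\<And>k. w k \<in> carrier_vec n"
    and step: "\<And>k. w (Suc k) = A *\<^sub>v w k"
    and w0: "w 0 \<noteq> 0\<^sub>v n"
    and bounded: "\<And>k i. i < n \<Longrightarrow> cmod (w k $ i) \<le> K"
  shows "\<exists>\<mu>. eigenvalue A \<mu> \<and> cmod \<mu> \<le> 1"
proof (rule ccontr)
  assume "\<not> ?thesis"
  then have large: "cmod \<mu> > 1" if "eigenvalue A \<mu>" for \<mu>
    using that by force
  from w0 w[of 0] obtain i where i: "i < n" "w 0 $ i \<noteq> 0"
    by (metis carrier_vecD eq_vecI index_zero_vec)
  then have n: "n > 0"
    by simp
  have "\<not> (\<exists>v. v \<in> carrier_vec n \<and> v \<noteq> 0\<^sub>v n \<and> A *\<^sub>v v = 0\<^sub>v n)"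
  proof
    assume "\<exists>v. v \<in> carrier_vec n \<and> v \<noteq> 0\<^sub>v n \<and> A *\<^sub>v v = 0\<^sub>v n"
    then have "eigenvalue A 0"
      unfolding eigenvalue_def eigenvector_def using A zero_smult_vec by fastforce
    from large[OF this] show False by simp
  qed
  then have "det A \<noteq> 0"
    using det_0_iff_vec_prod_zero[OF A] by blast
  from det_non_zero_imp_unit[OF A this] obtain B where B: "B \<in> carrier_mat n n"
    and BA: "B * A = 1\<^sub>m n" and AB: "A * B = 1\<^sub>m n"
    unfolding Units_def ring_mat_def by auto

  \<comment> \<open>Room is left between 1 and the least eigenvalue modulus \<open>r\<close>:
    scaling the inverse by \<open>s\<close> in between keeps its spectral radius below 1 and
    provides the growth factor.\<close>
  define r where "r = Min (cmod ` spectrum A)"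
  have fin: "finite (cmod ` spectrum A)" and ne: "cmod ` spectrum A \<noteq> {}"
    using card_finite_spectrum(1)[OF A] spectrum_non_empty[OF A n] by auto
  have r1: "r > 1"
    using Min_in[OF fin ne] large unfolding r_def spectrum_def by auto
  have r_le: "r \<le> cmod \<mu>" if "eigenvalue A \<mu>" for \<mu>
    using Min_le[OF fin] that unfolding r_def spectrum_def by auto
  define s where "s = (1 + r) / 2"
  have s: "1 < s" "s < r"
    using r1 unfolding s_def by auto
  define D where "D = complex_of_real s \<cdot>\<^sub>m B"
  have D: "D \<in> carrier_mat n n"
    unfolding D_def using B by simp
  \<comment> \<open>An eigenvalue \<open>\<nu>\<close> of \<open>D\<close> yields the eigenvalue
    \<open>s / \<nu>\<close> of \<open>A\<close>, whose modulus is at least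
    \<open>r > s\<close>.\<close>
  have "cmod \<nu> < 1" if "eigenvalue D \<nu>" for \<nu>
  proof -
    have ev: "eigenvalue B (\<nu> / complex_of_real s)"
      using eigenvalue_smult_mat[OF B _ that[unfolded D_def]] s by simp
    note eigenvalue_inverse_mat[OF A B AB ev]
    from this(1) r_le[OF this(2)] have "r * cmod \<nu> \<le> s" "cmod \<nu> > 0"
      using s by (auto simp: norm_divide field_simps)
    moreover have "s * cmod \<nu> < r * cmod \<nu>"
      using calculation(2) s by simp
    ultimately have "s * cmod \<nu> < s * 1"
      by linarith
    then show ?thesis
      using s by simp
  qed
  then have "spectral_radius D < 1"
    using spectral_radius_mem_max(1)[OF D n] unfolding spectrum_def by auto
  from spectral_radius_jnf_norm_bound_less_1_upper_triangular[OF D this]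
  obtain c where c: "\<And>k. norm_bound (D ^\<^sub>m k) c"
    by blast

  \<comment> \<open>Each factor \<open>D\<close> undoes one step of the orbit and contributes a
    factor \<open>s\<close>.\<close>
  have pow: "D ^\<^sub>m k *\<^sub>v w k = complex_of_real (s ^ k) \<cdot>\<^sub>v w 0" for k
  proof (induction k)
    case 0
    then show ?case using w[of 0] D by simp
  next
    case (Suc k)
    have BAw: "B *\<^sub>v (A *\<^sub>v w k) = w k"
      using A B BA w[of k] by (metis assoc_mult_mat_vec one_mult_mat_vec)
    have "D *\<^sub>v w (Suc k) = complex_of_real s \<cdot>\<^sub>v w k"
      unfolding D_def step smult_mat_mult_vec[OF B mult_mat_vec_carrier[OF A w]] BAw ..
    then have "D ^\<^sub>m Suc k *\<^sub>v w (Suc k) = D ^\<^sub>m k *\<^sub>v (complex_of_real s \<cdot>\<^sub>v w k)"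
      using D w[of "Suc k"] by (simp add: assoc_mult_mat_vec[of _ n n _ n])
    also have "\<dots> = complex_of_real s \<cdot>\<^sub>v (D ^\<^sub>m k *\<^sub>v w k)"
      using D w[of k] by (simp add: mult_mat_vec[of _ n n])
    finally show ?case
      unfolding Suc by (simp add: smult_smult_assoc)
  qed
  \<comment> \<open>Coordinate \<open>i\<close> of \<open>w 0\<close> is non-zero, so the left side
    grows without bound while the right side does not depend on \<open>k\<close>.\<close>
  have bound: "s ^ k * cmod (w 0 $ i) \<le> real n * (c * K)" for k
  proof -
    have Dk: "D ^\<^sub>m k \<in> carrier_mat n n"
      using D by simp
    have "s ^ k * cmod (w 0 $ i) = cmod ((D ^\<^sub>m k *\<^sub>v w k) $ i)"
      unfolding pow using i w[of 0] s by (simp add: norm_mult norm_power)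
    also have "(D ^\<^sub>m k *\<^sub>v w k) $ i = (\<Sum>j<n. (D ^\<^sub>m k) $$ (i, j) * w k $ j)"
      using i carrier_matD[OF Dk] carrier_vecD[OF w[of k]]
      by (simp add: scalar_prod_def lessThan_atLeast0 del: pow_mat_dim)
    also have "cmod \<dots> \<le> (\<Sum>j<n. c * K)"
    proof (rule sum_norm_le)
      fix j assume "j \<in> {..<n}"
      then have j: "j < n" by simp
      have "cmod ((D ^\<^sub>m k) $$ (i, j)) \<le> c"
        using c[of k] i j unfolding norm_bound_def carrier_matD[OF Dk] by blast
      then show "cmod ((D ^\<^sub>m k) $$ (i, j) * w k $ j) \<le> c * K"
        unfolding norm_mult using bounded[OF j, of k]
        by (intro mult_mono) (auto intro: order_trans[OF norm_ge_zero])
    qed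
    finally show ?thesis by simp
  qed
  obtain k where "real n * (c * K) / cmod (w 0 $ i) < s ^ k"
    using real_arch_pow[OF s(1)] by blast
  with bound[of k] i show False
    by (simp add: field_simps)
qed

section \<open>Counting lattice points\<close>

text \<open>The bijection need not preserve order, but it moves points by less than
  \<open>C\<close>. Hence the number \<open>n\<close> of points in \<open>[x 0, x n)\<close> differs
  boundedly from the number of lattice points there.\<close>

lemma bounded_distance_equiv_int_lattice:
  fixes x :: "int \<Rightarrow> real"
  assumes mono: "strict_mono x" and \<eta>: "\<eta> > 0"
    and bde: "bounded_distance_equiv (range x) (int_lattice \<eta>)"
  shows "\<exists>K. \<forall>n\<ge>0. \<bar>x n - x 0 - \<eta> * of_int n\<bar> \<le> K"
proof -
  from bde obtain g C where g: "bij_betw g (range x) (int_lattice \<eta>)"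
    and C: "\<And>m. \<bar>x m - g (x m)\<bar> < C"
    unfolding bounded_distance_equiv_def by blast
  have "\<exists>k::int. g (x m) = \<eta> * of_int k" for m
    using g unfolding bij_betw_def int_lattice_def by (metis imageE imageI rangeI)
  then obtain h :: "int \<Rightarrow> int" where h: "\<And>m. g (x m) = \<eta> * of_int (h m)"
    by metis
  have near: "\<bar>x m - \<eta> * of_int (h m)\<bar> < C" for m
    using C[of m] h by simp
  have inj: "inj h"
  proof (rule injI)
    fix p q assume "h p = h q"
    then have "g (x p) = g (x q)"
      using h by simp
    then have "x p = x q"
      using g unfolding bij_betw_def inj_on_def by blast
    then show "p = q"
      using strict_mono_eq[OF mono] by simp
  qed
  have surj: "\<exists>m. h m = k" for k
  proof -
    have "\<eta> * of_int k \<in> g ` range x"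
      using g unfolding bij_betw_def int_lattice_def by blast
    then obtain m where "\<eta> * of_int k = g (x m)"
      by blast
    then show ?thesis
      using h[of m] \<eta> by auto
  qed
  have "C > 0"
    using near[of 0] by linarith
  have "\<bar>x n - x 0 - \<eta> * of_int n\<bar> \<le> 2 * C + \<eta>" if n: "n \<ge> 0" for n
  proof -
    \<comment> \<open>Upper bound for \<open>n\<close>: the images of these \<open>n\<close> points
      are distinct lattice points in the interval widened by \<open>C\<close> at both ends.\<close>
    have "h ` {0..<n} \<subseteq> {\<lceil>(x 0 - C) / \<eta>\<rceil>..\<lfloor>(x n + C) / \<eta>\<rfloor>}"
    proof
      fix k assume "k \<in> h ` {0..<n}"
      then obtain m where m: "0 \<le> m" "m < n" and k: "k = h m"
        by auto
      have "x 0 \<le> x m" "x m < x n"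
        using m strict_mono_less_eq[OF mono] strict_mono_less[OF mono] by auto
      with near[of m] have "x 0 - C \<le> of_int k * \<eta>" "of_int k * \<eta> \<le> x n + C"
        unfolding k by (simp_all add: mult.commute)
      then show "k \<in> {\<lceil>(x 0 - C) / \<eta>\<rceil>..\<lfloor>(x n + C) / \<eta>\<rfloor>}"
        using \<eta> by (simp add: ceiling_le_iff le_floor_iff pos_divide_le_eq pos_le_divide_eq)
    qed
    from card_mono[OF _ this]
    have "nat n \<le> nat (\<lfloor>(x n + C) / \<eta>\<rfloor> - \<lceil>(x 0 - C) / \<eta>\<rceil> + 1)"
      using card_image[OF inj_on_subset[OF inj subset_UNIV], of "{0..<n}"] by simp
    \<comment> \<open>For \<open>n = 0\<close> the \<open>nat\<close> inequality says nothing, since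
      truncation may hide a negative count.\<close>
    then have "n = 0 \<or> n \<le> \<lfloor>(x n + C) / \<eta>\<rfloor> - \<lceil>(x 0 - C) / \<eta>\<rceil> + 1"
      using n by linarith
    then have upper: "\<eta> * of_int n \<le> x n - x 0 + 2 * C + \<eta>"
    proof
      assume "n = 0"
      then show ?thesis using \<open>C > 0\<close> \<eta> by simp
    next
      assume "n \<le> \<lfloor>(x n + C) / \<eta>\<rfloor> - \<lceil>(x 0 - C) / \<eta>\<rceil> + 1"
      then have "of_int n \<le> (x n + C) / \<eta> - (x 0 - C) / \<eta> + 1"
        by linarith
      also have "\<dots> = (x n - x 0 + 2 * C + \<eta>) / \<eta>"
        using \<eta> by (simp add: field_simps)
      finally show ?thesis
        using \<eta> by (simp add: pos_le_divide_eq mult.commute)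
    qed
    \<comment> \<open>Lower bound: shrinking the interval by \<open>C\<close> at both ends leaves
      only lattice points whose preimages lie strictly between \<open>x 0\<close> and
      \<open>x n\<close>.\<close>
    have "{\<lceil>(x 0 + C) / \<eta>\<rceil>..\<lfloor>(x n - C) / \<eta>\<rfloor>} \<subseteq> h ` {0..<n}"
    proof
      fix k assume "k \<in> {\<lceil>(x 0 + C) / \<eta>\<rceil>..\<lfloor>(x n - C) / \<eta>\<rfloor>}"
      then have k: "x 0 + C \<le> of_int k * \<eta>" "of_int k * \<eta> \<le> x n - C"
        using \<eta> by (simp_all add: ceiling_le_iff le_floor_iff pos_divide_le_eq pos_le_divide_eq)
      obtain m where m: "h m = k"
        using surj by blast
      have "x 0 < x m" "x m < x n"
        using k near[of m] unfolding m by (simp_all add: mult.commute)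
      then show "k \<in> h ` {0..<n}"
        using m strict_mono_less[OF mono] by force
    qed
    from card_mono[OF _ this]
    have "nat (\<lfloor>(x n - C) / \<eta>\<rfloor> - \<lceil>(x 0 + C) / \<eta>\<rceil> + 1) \<le> nat n"
      using card_image[OF inj_on_subset[OF inj subset_UNIV], of "{0..<n}"] by simp
    then have "\<lfloor>(x n - C) / \<eta>\<rfloor> - \<lceil>(x 0 + C) / \<eta>\<rceil> + 1 \<le> n"
      using n by linarith
    then have "(x n - C) / \<eta> - (x 0 + C) / \<eta> - 1 \<le> of_int n"
      by linarith
    moreover have "(x n - C) / \<eta> - (x 0 + C) / \<eta> - 1 = (x n - x 0 - 2 * C - \<eta>) / \<eta>"
      using \<eta> by (simp add: field_simps)
    ultimately have "x n - x 0 - 2 * C - \<eta> \<le> \<eta> * of_int n"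
      using \<eta> by (simp add: pos_divide_le_eq mult.commute)
    with upper show ?thesis
      by linarith
  qed
  then show ?thesis by blast
qed

section \<open>Substitutions and their fixed points\<close>

lemma morph_append: "morph \<phi> (v @ w) = morph \<phi> v @ morph \<phi> w"
  by (simp add: morph_def)

lemma morph_pow_append: "(morph \<phi> ^^ k) (v @ w) = (morph \<phi> ^^ k) v @ (morph \<phi> ^^ k) w"
  by (induction k) (simp_all add: morph_append)

lemma morph_pow_Nil: "(morph \<phi> ^^ k) [] = []"
  by (induction k) (simp_all add: morph_def)

lemma sum_list_morph_pow:
  "sum_list (map f ((morph \<phi> ^^ k) w)) = (\<Sum>b\<leftarrow>w. sum_list (map f ((morph \<phi> ^^ k) [b])))"
proof (induction w)
  case (Cons b w)
  then show ?case
    using morph_pow_append[of k \<phi> "[b]" w] by simp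
qed (simp add: morph_pow_Nil)

text \<open>Links weights of words to linear algebra: the weight is the product of the row vector
  \<open>f\<close> with the Parikh vector of \<open>w\<close>.\<close>

lemma sum_list_map_count_list:
  fixes f :: "nat \<Rightarrow> 'a :: comm_semiring_1"
  assumes "set w \<subseteq> {1..d}"
  shows "sum_list (map f w) = (\<Sum>i<d. of_nat (count_list w (Suc i)) * f (Suc i))"
  using assms
proof (induction w)
  case (Cons b w)
  then obtain j where j: "b = Suc j" "j < d"
    by (cases b) auto
  have "(\<Sum>i<d. of_nat (count_list (b # w) (Suc i)) * f (Suc i)) =
      (\<Sum>i<d. of_nat (count_list w (Suc i)) * f (Suc i) + (if i = j then f (Suc i) else 0))"
    by (intro sum.cong) (auto simp: j algebra_simps)
  also have "\<dots> = (\<Sum>i<d. of_nat (count_list w (Suc i)) * f (Suc i)) + f b"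
    using j by (simp add: sum.distrib)
  finally show ?case
    using Cons by (simp add: add.commute)
qed simp

lemma biinf_word_letter: "biinf_word d u \<Longrightarrow> u n \<in> {1..d}"
  unfolding biinf_word_def by blast

text \<open>Keeps the \<open>nth\<close> access in \<open>morph_biinf\<close> within range.\<close>

lemma length_morph_ge:
  assumes "substitution d \<phi>" and "set w \<subseteq> {1..d}"
  shows "length w \<le> length (morph \<phi> w)"
  using assms(2)
proof (induction w)
  case (Cons b w)
  then have "length (\<phi> b) > 0"
    using assms(1) unfolding substitution_def by auto
  moreover have "length w \<le> length (morph \<phi> w)"
    using Cons by simp
  ultimately have "length (b # w) \<le> length (\<phi> b) + length (morph \<phi> w)"
    unfolding list.size by linarith
  then show ?case
    by (simp add: morph_def)
qed simp

text \<open>Only the right half of the word is used for the orbit; indexing by \<open>nat\<close>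
  allows induction on the length.\<close>

definition word_prefix :: "(int \<Rightarrow> nat) \<Rightarrow> nat \<Rightarrow> nat list" where
  "word_prefix u n = map (\<lambda>i. u (int i)) [0..<n]"

lemma word_prefix_Suc: "word_prefix u (Suc n) = word_prefix u n @ [u (int n)]"
  by (simp add: word_prefix_def)

lemma word_prefix_add: "\<exists>v. word_prefix u (n + k) = word_prefix u n @ v"
  by (simp add: word_prefix_def upt_add_eq_append[of 0])

lemma map_upto_eq_word_prefix: "map u [0..int n - 1] = word_prefix u n"
  unfolding word_prefix_def by (rule nth_equalityI) simp_all

lemma morph_word_prefix:
  assumes \<phi>: "substitution d \<phi>" and u: "biinf_word d u" and fix_u: "morph_biinf \<phi> u = u"
  shows "morph \<phi> (word_prefix u n) = word_prefix u (length (morph \<phi> (word_prefix u n)))"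
proof (rule nth_equalityI)
  show "length (morph \<phi> (word_prefix u n)) =
      length (word_prefix u (length (morph \<phi> (word_prefix u n))))"
    by (simp add: word_prefix_def)
next
  fix i assume i: "i < length (morph \<phi> (word_prefix u n))"
  have "set (word_prefix u (Suc i)) \<subseteq> {1..d}"
    using biinf_word_letter[OF u] by (auto simp: word_prefix_def)
  from length_morph_ge[OF \<phi> this] have i': "i < length (morph \<phi> (word_prefix u (Suc i)))"
    by (simp add: word_prefix_def)
  have "u (int i) = morph \<phi> (word_prefix u (Suc i)) ! i"
    using fun_cong[OF fix_u, of "int i"] map_upto_eq_word_prefix[of u "Suc i"]
    by (simp add: morph_biinf_def)
  \<comment> \<open>Of the prefixes of lengths \<open>Suc i\<close> and \<open>n\<close> one extends
    the other, so the same holds for their images; both images are long enough to have a position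
    \<open>i\<close>.\<close>
  also have "\<dots> = morph \<phi> (word_prefix u n) ! i"
  proof (cases "Suc i \<le> n")
    case True
    then show ?thesis
      using word_prefix_add[of u "Suc i" "n - Suc i"] i' by (auto simp: morph_append nth_append)
  next
    case False
    then show ?thesis
      using word_prefix_add[of u n "Suc i - n"] i by (auto simp: morph_append nth_append)
  qed
  finally show "morph \<phi> (word_prefix u n) ! i =
      word_prefix u (length (morph \<phi> (word_prefix u n))) ! i"
    using i by (simp add: word_prefix_def)
qed

lemma morph_pow_word_prefix:
  assumes "substitution d \<phi>" and "biinf_word d u" and "morph_biinf \<phi> u = u"
  shows "\<exists>m. (morph \<phi> ^^ k) (word_prefix u n) = word_prefix u m"
proof (induction k)
  case (Suc k)
  then show ?case
    using morph_word_prefix[OF assms] by (metis comp_apply funpow.simps(2))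
qed auto

text \<open>By primitivity some iterated image of the letter \<open>u 0\<close> contains all
  letters, and this image is itself a prefix of the right half.\<close>

lemma letter_occurs_in_fixed_point:
  assumes \<phi>: "primitive_substitution d \<phi>" and u: "biinf_word d u"
    and fix_u: "morph_biinf \<phi> u = u" and b: "b \<in> {1..d}"
  shows "\<exists>n. b = u (int n)"
proof -
  from \<phi> obtain k where sub: "substitution d \<phi>"
    and k: "\<forall>a\<in>{1..d}. \<forall>b\<in>{1..d}. b \<in> set ((morph \<phi> ^^ k) [a])"
    unfolding primitive_substitution_def by blast
  have "b \<in> set ((morph \<phi> ^^ k) [u 0])"
    using k b biinf_word_letter[OF u] by blast
  then have "b \<in> set ((morph \<phi> ^^ k) (word_prefix u 1))"
    by (simp add: word_prefix_def)
  moreover obtain m where "(morph \<phi> ^^ k) (word_prefix u 1) = word_prefix u m"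
    using morph_pow_word_prefix[OF sub u fix_u] by blast
  ultimately show ?thesis
    by (auto simp: word_prefix_def)
qed

section \<open>Geometric representations\<close>

lemma scalar_prod_parikh:
  assumes l: "l \<in> carrier_vec d" and w: "set w \<subseteq> {1..d}"
  shows "l \<bullet> parikh d w = (\<Sum>b\<leftarrow>w. l $ (b - 1))"
  using sum_list_map_count_list[OF w, of "\<lambda>b. l $ (b - 1)"]
  by (simp add: scalar_prod_def parikh_def lessThan_atLeast0 mult.commute)

lemma scalar_prod_parikh_biinf_step:
  assumes l: "l \<in> carrier_vec d" and u: "biinf_word d u"
  shows "l \<bullet> parikh_biinf d u (n + 1) = l \<bullet> parikh_biinf d u n + l $ (u n - 1)"
proof -
  have set_u: "set (map u xs) \<subseteq> {1..d}" for xs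
    using biinf_word_letter[OF u] by auto
  have neg: "l \<bullet> (- parikh d w) = - (l \<bullet> parikh d w)" for w
    using l by (intro scalar_prod_uminus_right) (simp add: parikh_def)
  note weight = scalar_prod_parikh[OF l set_u]
  \<comment> \<open>The case \<open>n = -1\<close> crosses the origin, where
    \<open>parikh_biinf\<close> changes branch and the new prefix is empty.\<close>
  consider "n \<ge> 0" | "n = -1" | "n < -1"
    by linarith
  then show ?thesis
  proof cases
    case 1
    then have "map u [0..n] = map u [0..n - 1] @ map u [n]"
      by (simp add: upto_rec2)
    then have "(\<Sum>b\<leftarrow>map u [0..n]. l $ (b - 1)) =
        (\<Sum>b\<leftarrow>map u [0..n - 1]. l $ (b - 1)) + l $ (u n - 1)"
      by simp
    with 1 show ?thesis
      by (simp add: parikh_biinf_def weight)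
  next
    case 2
    then show ?thesis
      using weight[of "[]"] weight[of "[-1]"] by (simp add: parikh_biinf_def neg)
  next
    case 3
    then show ?thesis
      using weight[of "[n..-1]"] weight[of "[n + 1..-1]"]
      by (simp add: parikh_biinf_def neg upto_rec1[of n])
  qed
qed

lemma strict_mono_int_step:
  fixes x :: "int \<Rightarrow> 'a :: order"
  assumes "\<And>n. x n < x (n + 1)"
  shows "strict_mono x"
proof (rule strict_monoI)
  fix m n :: int assume "m < n"
  then show "x m < x n"
    by (induction n rule: int_gr_induct) (use assms in \<open>auto intro: less_trans\<close>)
qed

text \<open>The weight of the prefix of length \<open>n\<close> telescopes to
  \<open>x n - x 0 - \<eta> * n\<close>; positive lengths make \<open>x\<close> strictly increasing,
  as the counting argument requires.\<close>

lemma bounded_prefix_weights: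
  assumes l: "lengths d l" and u: "biinf_word d u" and \<eta>: "\<eta> > 0"
    and bde: "bounded_distance_equiv (geometric_rep d l u) (int_lattice \<eta>)"
  shows "\<exists>K. \<forall>n. \<bar>\<Sum>b\<leftarrow>word_prefix u n. l $ (b - 1) - \<eta>\<bar> \<le> K"
proof -
  define x where "x n = l \<bullet> parikh_biinf d u n" for n
  have lc: "l \<in> carrier_vec d"
    using l by (simp add: lengths_def)
  have "strict_mono x"
  proof (rule strict_mono_int_step)
    fix n
    have "l $ (u n - 1) > 0"
      using l biinf_word_letter[OF u, of n] by (auto simp: lengths_def)
    then show "x n < x (n + 1)"
      unfolding x_def scalar_prod_parikh_biinf_step[OF lc u] by simp
  qed
  moreover have "geometric_rep d l u = range x"
    by (simp add: geometric_rep_def x_def)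
  ultimately obtain K where K: "\<And>n. n \<ge> 0 \<Longrightarrow> \<bar>x n - x 0 - \<eta> * of_int n\<bar> \<le> K"
    using bounded_distance_equiv_int_lattice[of x \<eta>] \<eta> bde by auto
  have "(\<Sum>b\<leftarrow>word_prefix u n. l $ (b - 1) - \<eta>) = x (int n) - x 0 - \<eta> * of_int (int n)" for n
  proof (induction n)
    case 0
    then show ?case by (simp add: word_prefix_def)
  next
    case (Suc n)
    then show ?case
      using scalar_prod_parikh_biinf_step[OF lc u, of "int n"]
      by (simp add: word_prefix_Suc x_def algebra_simps)
  qed
  then show ?thesis
    using K by (metis of_nat_0_le_iff)
qed

theorem mainTheorem2:
  fixes d :: nat and \<phi> :: "nat \<Rightarrow> nat list" and u :: "int \<Rightarrow> nat"
  assumes "primitive_substitution d \<phi>"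
    and "biinf_word d u"
    and "morph_biinf \<phi> u = u"
    and "\<exists>l. lengths d l \<and> nontrivial_lengths d l \<and>
           (\<exists>\<eta>>0. bounded_distance_equiv (geometric_rep d l u) (int_lattice \<eta>))"
  shows "\<exists>\<mu>. eigenvalue (incidence_matrix d \<phi>) \<mu> \<and> cmod \<mu> \<le> 1"
proof -
  note prim = assms(1) and u = assms(2) and fix_u = assms(3)
  have sub: "substitution d \<phi>"
    using prim by (simp add: primitive_substitution_def)
  from assms(4) obtain l \<eta> where l: "lengths d l" and nontriv: "nontrivial_lengths d l"
    and \<eta>: "\<eta> > 0" and bde: "bounded_distance_equiv (geometric_rep d l u) (int_lattice \<eta>)"
    by blast
  define f where "f b = l $ (b - 1) - \<eta>" for b
  obtain K where K: "\<And>n. \<bar>sum_list (map f (word_prefix u n))\<bar> \<le> K"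
    using bounded_prefix_weights[OF l u \<eta> bde] unfolding f_def by blast
  define F where "F k b = sum_list (map f ((morph \<phi> ^^ k) [b]))" for k b

  \<comment> \<open>At an occurrence of \<open>b\<close> in the right half, its iterated image is
    what separates two prefixes of \<open>u\<close>, each of weight at most \<open>K\<close> in
    modulus.\<close>
  have bounded: "\<bar>F k b\<bar> \<le> 2 * K" if b_letter: "b \<in> {1..d}" for k b
  proof -
    obtain n where b: "b = u (int n)"
      using letter_occurs_in_fixed_point[OF prim u fix_u b_letter] by blast
    obtain p q where "(morph \<phi> ^^ k) (word_prefix u n) = word_prefix u p"
      and "(morph \<phi> ^^ k) (word_prefix u (Suc n)) = word_prefix u q"
      using morph_pow_word_prefix[OF sub u fix_u] by meson
    then have "word_prefix u q = word_prefix u p @ (morph \<phi> ^^ k) [b]"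
      by (simp add: word_prefix_Suc morph_pow_append b)
    then have "F k b = sum_list (map f (word_prefix u q)) - sum_list (map f (word_prefix u p))"
      by (simp add: F_def)
    then show ?thesis
      using K[of p] K[of q] by linarith
  qed

  \<comment> \<open>The transpose turns the row vectors \<open>f M\<^sup>k\<close> into an orbit of
    column vectors.\<close>
  define A where "A = transpose_mat (incidence_matrix d \<phi>)"
  have M: "incidence_matrix d \<phi> \<in> carrier_mat d d"
    by (simp add: incidence_matrix_def)
  then have A: "A \<in> carrier_mat d d"
    by (simp add: A_def)
  define w where "w k = vec d (\<lambda>i. complex_of_real (F k (Suc i)))" for k
  have step: "w (Suc k) = A *\<^sub>v w k" for k
  proof (rule eq_vecI)
    fix i assume "i < dim_vec (A *\<^sub>v w k)"
    then have i: "i < d"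
      using A by simp
    then have "set (\<phi> (Suc i)) \<subseteq> {1..d}"
      using sub by (simp add: substitution_def)
    note count = sum_list_map_count_list[OF this]
    \<comment> \<open>Peeling off the innermost application of \<open>\<phi>\<close>, not the
      outermost, makes the recurrence linear in \<open>F k\<close>.\<close>
    have "F (Suc k) (Suc i) = sum_list (map f ((morph \<phi> ^^ k) (\<phi> (Suc i))))"
      by (simp add: F_def funpow_Suc_right morph_def del: funpow.simps)
    also have "\<dots> = (\<Sum>j<d. of_nat (count_list (\<phi> (Suc i)) (Suc j)) * F k (Suc j))"
      unfolding sum_list_morph_pow[of f k \<phi> "\<phi> (Suc i)"] count by (simp add: F_def)
    finally show "w (Suc k) $ i = (A *\<^sub>v w k) $ i"
      using i by (simp add: w_def A_def incidence_matrix_def scalar_prod_def lessThan_atLeast0)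
  qed (use A in \<open>simp add: w_def\<close>)
  \<comment> \<open>The entries of \<open>w 0\<close> are the \<open>f\<close> weights of the
    letters; if all vanished, every length would equal \<open>\<eta>\<close>.\<close>
  have "w 0 \<noteq> 0\<^sub>v d"
  proof
    assume w0: "w 0 = 0\<^sub>v d"
    have "l $ i = \<eta>" if "i < d" for i
      using arg_cong[OF w0, of "\<lambda>v. v $ i"] that by (simp add: w_def F_def f_def)
    with nontriv show False
      by (auto simp: nontrivial_lengths_def)
  qed
  moreover have "cmod (w k $ i) \<le> 2 * K" if "i < d" for k i
    using bounded[of "Suc i" k] that by (simp add: w_def)
  ultimately obtain \<mu> where "eigenvalue A \<mu>" "cmod \<mu> \<le> 1"
    using bounded_orbit_eigenvalue[OF A, of w "2 * K"] step by (auto simp: w_def)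
  \<comment> \<open>A matrix and its transpose share the characteristic polynomial, hence the
    eigenvalues.\<close>
  then show ?thesis
    using eigenvalue_root_char_poly[OF A] eigenvalue_root_char_poly[OF M]
      char_poly_transpose_mat[OF M] unfolding A_def by auto
qed

end
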